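(* For every fixed integer $k\ge 2$, $\operatorname{ex}_{2^{k-1}}(n,\mathrm{VD}_k^\circ)=\Omega_k\bigl(n^{2^{k-1}-1}\bigr)$. Moreover, for every fixed integer $k\ge 2$ and every fixed integer $r\ge 2^{k-1}$ there are $r$-uniform hypergraphs on $n$ vertices with $\Omega_{k,r}\bigl(n^{2^{k-1}-1}\bigr)$ edges which contain no trace copy of $\mathrm{VD}_k$. Here $\Omega_k(\cdot)$ and $\Omega_{k,r}(\cdot)$ mean: at least a positive constant, depending only on the subscripts, times the given quantity, for all sufficiently large $n$.
   Context: A hypergraph $H$ is a finite vertex set $V(H)$ with a set system $E(H)\subseteq\mathcal P(V(H))$; it is $r$-uniform if all edges have size $r$. For $S\subseteq V(H)$, the trace of $H$ on $S$ is the hypergraph on $S$ with edge set $H|_S=\{E\cap S:E\in E(H)\}$. $H$ contains a trace copy of a hypergraph $F$ if $H|_S$ contains a subhypergraph isomorphic to $F$ for some $S\subseteq V(H)$. The $k$-Venn diagram $\mathrm{VD}_k$ is the hypergraph with vertex set $2^{[k]}$ (all subsets of $[k]=\{1,\dots,k\}$) and $k$ edges $E_i=\{A\subseteq[k]: i\in A\}$, $i=1,\dots,k$. $\mathrm{VD}_k^\circ$ is obtained from $\mathrm{VD}_k$ by deleting the vertex $\emptyset$ (which lies in no edge); it is a $2^{k-1}$-uniform hypergraph on $2^k-1$ vertices with $k$ edges. $\operatorname{ex}_r(n,F)$ denotes the maximum number of edges in an $r$-uniform $n$-vertex hypergraph containing no copy of $F$ as a subhypergraph (not necessarily induced). *)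

theory Defs
  imports Complex_Main "HOL-Library.Landau_Symbols"
begin

record 'a hypergraph =
  hverts :: "'a set"
  hedges :: "'a set set"

definition is_hypergraph :: "'a hypergraph \<Rightarrow> bool" where
  "is_hypergraph H \<longleftrightarrow> finite (hverts H) \<and> hedges H \<subseteq> Pow (hverts H)"

definition uniform :: "nat \<Rightarrow> 'a hypergraph \<Rightarrow> bool" where
  "uniform r H \<longleftrightarrow> (\<forall>E\<in>hedges H. card E = r)"

definition subhypergraph :: "'a hypergraph \<Rightarrow> 'a hypergraph \<Rightarrow> bool" where
  "subhypergraph G H \<longleftrightarrow>
     is_hypergraph G \<and> hverts G \<subseteq> hverts H \<and> hedges G \<subseteq> hedges H"

definition hyp_isomorphic :: "'a hypergraph \<Rightarrow> 'b hypergraph \<Rightarrow> bool" where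
  "hyp_isomorphic G F \<longleftrightarrow>
     (\<exists>f. bij_betw f (hverts G) (hverts F) \<and> hedges F = (\<lambda>E. f ` E) ` hedges G)"

definition contains_copy :: "'a hypergraph \<Rightarrow> 'b hypergraph \<Rightarrow> bool" where
  "contains_copy H F \<longleftrightarrow> (\<exists>G. subhypergraph G H \<and> hyp_isomorphic G F)"

definition hyp_trace :: "'a hypergraph \<Rightarrow> 'a set \<Rightarrow> 'a hypergraph" where
  "hyp_trace H S = \<lparr>hverts = S, hedges = {E \<inter> S | E. E \<in> hedges H}\<rparr>"

definition contains_trace_copy :: "'a hypergraph \<Rightarrow> 'b hypergraph \<Rightarrow> bool" where
  "contains_trace_copy H F \<longleftrightarrow> (\<exists>S\<subseteq>hverts H. contains_copy (hyp_trace H S) F)"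

text \<open>Vertices are drawn from \<^typ>\<open>nat\<close>; every finite hypergraph is isomorphic to such a one.
  If \<open>F\<close> has at least one edge, the maximum is over a finite nonempty set
  (see \<open>turan_set_finite\<close> and \<open>turan_set_nonempty\<close> below).\<close>

definition turan_ex :: "nat \<Rightarrow> nat \<Rightarrow> 'b hypergraph \<Rightarrow> nat" where
  "turan_ex r n F =
     Max {card (hedges H) | H :: nat hypergraph.
            is_hypergraph H \<and> uniform r H \<and> card (hverts H) = n \<and> \<not> contains_copy H F}"

definition VD_edge :: "nat \<Rightarrow> nat \<Rightarrow> nat set set" where
  "VD_edge k i = {A. A \<subseteq> {1..k} \<and> i \<in> A}"

definition VD :: "nat \<Rightarrow> nat set hypergraph" where
  "VD k = \<lparr>hverts = Pow {1..k}, hedges = {VD_edge k i | i. i \<in> {1..k}}\<rparr>"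

definition VD_circ :: "nat \<Rightarrow> nat set hypergraph" where
  "VD_circ k = \<lparr>hverts = hverts (VD k) - {{}}, hedges = hedges (VD k)\<rparr>"

lemma is_hypergraph_VD: "is_hypergraph (VD k)"
  by (auto simp: is_hypergraph_def VD_def VD_edge_def)

lemma is_hypergraph_VD_circ: "is_hypergraph (VD_circ k)"
  by (auto simp: is_hypergraph_def VD_circ_def VD_def VD_edge_def)

lemma card_hverts_VD_circ: "card (hverts (VD_circ k)) = 2 ^ k - 1"
  by (simp add: VD_circ_def VD_def card_Pow)

lemma card_hedges_VD_circ: "card (hedges (VD_circ k)) = k"
proof -
  have "inj_on (VD_edge k) {1..k}"
  proof (rule inj_onI)
    fix i j assume i: "i \<in> {1..k}" and eq: "VD_edge k i = VD_edge k j"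
    have "{i} \<in> VD_edge k i" using i by (simp add: VD_edge_def)
    then have "{i} \<in> VD_edge k j" using eq by simp
    then show "i = j" by (simp add: VD_edge_def)
  qed
  moreover have "hedges (VD_circ k) = VD_edge k ` {1..k}"
    by (auto simp: VD_circ_def VD_def)
  ultimately show ?thesis by (simp add: card_image)
qed

lemma uniform_VD_circ: "uniform (2 ^ (k - 1)) (VD_circ k)"
proof -
  have "card (VD_edge k i) = 2 ^ (k - 1)" if i: "i \<in> {1..k}" for i
  proof -
    have "VD_edge k i = insert i ` Pow ({1..k} - {i})"
    proof
      show "VD_edge k i \<subseteq> insert i ` Pow ({1..k} - {i})"
      proof
        fix A assume "A \<in> VD_edge k i"
        then have "A = insert i (A - {i})" "A - {i} \<in> Pow ({1..k} - {i})"
          unfolding VD_edge_def by blast+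
        then show "A \<in> insert i ` Pow ({1..k} - {i})" by (rule image_eqI)
      qed
      show "insert i ` Pow ({1..k} - {i}) \<subseteq> VD_edge k i"
        using i unfolding VD_edge_def by blast
    qed
    moreover have "inj_on (insert i) (Pow ({1..k} - {i}))"
      by (rule inj_onI) blast
    ultimately show ?thesis using i by (simp add: card_image card_Pow)
  qed
  then show ?thesis by (auto simp: uniform_def VD_circ_def VD_def)
qed

lemma turan_set_finite:
  "finite {card (hedges H) | H :: nat hypergraph.
            is_hypergraph H \<and> uniform r H \<and> card (hverts H) = n \<and> \<not> contains_copy H F}"
proof (rule finite_subset)
  show "{card (hedges H) | H :: nat hypergraph.
            is_hypergraph H \<and> uniform r H \<and> card (hverts H) = n \<and> \<not> contains_copy H F}
        \<subseteq> {..2 ^ n}"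
  proof safe
    fix H :: "nat hypergraph" assume "is_hypergraph H" "n = card (hverts H)"
    then show "card (hedges H) \<le> 2 ^ card (hverts H)"
      unfolding is_hypergraph_def by (metis card_Pow card_mono finite_Pow_iff)
  qed
qed simp

lemma turan_set_nonempty:
  assumes "hedges F \<noteq> {}"
  shows "{card (hedges H) | H :: nat hypergraph.
            is_hypergraph H \<and> uniform r H \<and> card (hverts H) = n \<and> \<not> contains_copy H F} \<noteq> {}"
proof -
  let ?H = "\<lparr>hverts = {..<n}, hedges = {}\<rparr> :: nat hypergraph"
  have "is_hypergraph ?H \<and> uniform r ?H \<and> card (hverts ?H) = n \<and> \<not> contains_copy ?H F"
    using assms
    by (auto simp: is_hypergraph_def uniform_def contains_copy_def subhypergraph_def
        hyp_isomorphic_def)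
  then show ?thesis by blast
qed

end

theory Submission
  imports Defs
begin

text \<open>
  In a copy of the Venn diagram every edge has to be split by the other edges into
  \<open>2 ^ (k - 1)\<close> nonempty regions, one for each set of indices containing its own. A hypergraph
  whose edges are unions of only \<open>2 ^ (k - 1) - 1\<close> indivisible blocks of vertices therefore
  contains no copy, and passing to traces does not help, since a trace cannot separate vertices
  that lie in the same edges. On the other hand, choosing the blocks freely gives about
  \<open>n ^ (2 ^ (k - 1) - 1)\<close> edges, and the uniformity \<open>r\<close> can be made any number
  \<open>\<ge> 2 ^ (k - 1)\<close> by making one of the blocks large.

  Concretely, with \<open>d = 2 ^ (k - 1)\<close> an edge is one block of size \<open>r - d + 2\<close> together with
  \<open>d - 2\<close> single vertices taken from a separate part of the vertex set. The obstruction is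
  \<open>venn_family_edge_bound\<close> and the count is \<open>card_block_edges\<close> with \<open>block_edges_growth\<close>.
  The same hypergraph proves both claims; for the Turan number it is used with \<open>r = d\<close>.
\<close>

section \<open>Venn families\<close>

text \<open>The common content of ordinary copies of \<open>VD_circ k\<close> and trace copies of \<open>VD k\<close>.
  The region outside all sets is left unconstrained: \<open>VD_circ k\<close> has no vertex for it.\<close>

definition venn_family :: "nat \<Rightarrow> (nat \<Rightarrow> 'a set) \<Rightarrow> bool" where
  "venn_family k E \<longleftrightarrow> (\<forall>A \<subseteq> {1..k}. A \<noteq> {} \<longrightarrow> (\<exists>v. {i \<in> {1..k}. v \<in> E i} = A))"

lemma venn_family_if_contains_copy:
  assumes "contains_copy H F" and edges: "hedges F = hedges (VD k)"
    and verts: "Pow {1..k} - {{}} \<subseteq> hverts F"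
  shows "\<exists>E. (\<forall>i\<in>{1..k}. E i \<in> hedges H) \<and> venn_family k E"
proof -
  from assms(1) obtain G f where G: "subhypergraph G H"
    and bij: "bij_betw f (hverts G) (hverts F)"
    and im: "hedges F = (\<lambda>E. f ` E) ` hedges G"
    unfolding contains_copy_def hyp_isomorphic_def by blast
  have "\<forall>i\<in>{1..k}. \<exists>D\<in>hedges G. f ` D = VD_edge k i"
  proof
    fix i assume "i \<in> {1..k}"
    then have "VD_edge k i \<in> hedges F" unfolding edges by (auto simp: VD_def)
    then show "\<exists>D\<in>hedges G. f ` D = VD_edge k i" unfolding im by auto
  qed
  then obtain E where E: "\<And>i. i \<in> {1..k} \<Longrightarrow> E i \<in> hedges G \<and> f ` E i = VD_edge k i"
    by metis
  have sub: "E i \<subseteq> hverts G" if "i \<in> {1..k}" for i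
    using E[OF that] G unfolding subhypergraph_def is_hypergraph_def by blast
  have "\<exists>v. {i \<in> {1..k}. v \<in> E i} = A" if A: "A \<subseteq> {1..k}" "A \<noteq> {}" for A
  proof -
    have "A \<in> f ` hverts G" using A verts bij_betw_imp_surj_on[OF bij] by blast
    then obtain v where v: "v \<in> hverts G" "f v = A" by blast
    have "v \<in> E i \<longleftrightarrow> i \<in> A" if i: "i \<in> {1..k}" for i
    proof -
      have "v \<in> E i \<longleftrightarrow> f v \<in> f ` E i"
        using inj_on_image_mem_iff[OF bij_betw_imp_inj_on[OF bij] v(1) sub[OF i]] by simp
      also have "\<dots> \<longleftrightarrow> i \<in> A"
        using E[OF i] v(2) A(1) by (simp add: VD_edge_def)
      finally show ?thesis .
    qed
    then have "{i \<in> {1..k}. v \<in> E i} = A" using A(1) by blast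
    then show ?thesis ..
  qed
  moreover have "\<forall>i\<in>{1..k}. E i \<in> hedges H"
    using E G unfolding subhypergraph_def by blast
  ultimately show ?thesis unfolding venn_family_def by blast
qed

text \<open>A vertex witnessing a nonempty region lies in some traced edge, hence in \<open>S\<close>, where an edge
  and its trace agree; so the untraced edges realise the same regions.\<close>

lemma venn_family_if_contains_trace_copy:
  assumes "contains_trace_copy H (VD k)"
  shows "\<exists>E. (\<forall>i\<in>{1..k}. E i \<in> hedges H) \<and> venn_family k E"
proof -
  from assms obtain S where "contains_copy (hyp_trace H S) (VD k)"
    unfolding contains_trace_copy_def by blast
  from venn_family_if_contains_copy[OF this refl] obtain D
    where D: "\<forall>i\<in>{1..k}. D i \<in> hedges (hyp_trace H S)" and venn: "venn_family k D"
    by (auto simp: VD_def)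
  have "\<forall>i\<in>{1..k}. \<exists>E\<in>hedges H. D i = E \<inter> S"
    using D by (auto simp: hyp_trace_def)
  then obtain E where E: "\<And>i. i \<in> {1..k} \<Longrightarrow> E i \<in> hedges H \<and> D i = E i \<inter> S"
    by metis
  have "venn_family k E"
    unfolding venn_family_def
  proof (intro allI impI)
    fix A assume A: "A \<subseteq> {1..k}" "A \<noteq> {}"
    then obtain v where v: "{i \<in> {1..k}. v \<in> D i} = A"
      using venn unfolding venn_family_def by blast
    with A(2) E have "v \<in> S" by blast
    with v E have "{i \<in> {1..k}. v \<in> E i} = A" by blast
    then show "\<exists>v. {i \<in> {1..k}. v \<in> E i} = A" ..
  qed
  with E show ?thesis by blast
qed

text \<open>The vertices of one member of a Venn family realise all \<open>2 ^ (k - 1)\<close> incidence patterns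
  containing its index, while \<open>B\<close> contributes at most one pattern and each vertex of \<open>T\<close>
  at most one more.\<close>

lemma venn_family_edge_bound:
  assumes venn: "venn_family k E" and j: "j \<in> {1..k}"
    and split: "E j = B \<union> T" and fin: "finite T"
    and twins: "\<And>i u v. \<lbrakk>i \<in> {1..k}; u \<in> B; v \<in> B\<rbrakk> \<Longrightarrow> u \<in> E i \<longleftrightarrow> v \<in> E i"
  shows "2 ^ (k - 1) \<le> card T + 1"
proof -
  define sig where "sig v = {i \<in> {1..k}. v \<in> E i}" for v
  \<comment> \<open>Any representative of \<open>B\<close> will do; if \<open>B\<close> is empty, its pattern is merely superfluous.\<close>
  define b where "b = (SOME b. b \<in> B)"
  have "VD_edge k j \<subseteq> insert (sig b) (sig ` T)"
  proof
    fix A assume A: "A \<in> VD_edge k j"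
    then obtain v where v: "sig v = A"
      using venn unfolding venn_family_def VD_edge_def sig_def by blast
    have "v \<in> E j" using v A j by (auto simp: sig_def VD_edge_def)
    then consider "v \<in> B" | "v \<in> T" using split by blast
    then show "A \<in> insert (sig b) (sig ` T)"
    proof cases
      case 1
      then have "b \<in> B" unfolding b_def by (rule someI)
      with 1 twins have "sig v = sig b" unfolding sig_def by blast
      with v show ?thesis by simp
    qed (use v in blast)
  qed
  then have "card (VD_edge k j) \<le> card (insert (sig b) (sig ` T))"
    using fin by (intro card_mono) auto
  also have "\<dots> \<le> card (sig ` T) + 1"
    using fin by (simp add: card_insert_if)
  also have "\<dots> \<le> card T + 1" using card_image_le[OF fin] by simp
  finally have "card (VD_edge k j) \<le> card T + 1" .
  moreover have "card (VD_edge k j) = 2 ^ (k - 1)"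
    using uniform_VD_circ[of k] j by (auto simp: uniform_def VD_circ_def VD_def)
  ultimately show ?thesis by simp
qed

section \<open>Edges made of one block and single vertices\<close>

text \<open>The first \<open>m * s\<close> vertices form \<open>m\<close> blocks of size \<open>s\<close>, the next \<open>m\<close> vertices are the ones
  that may be chosen individually.\<close>

definition block :: "nat \<Rightarrow> nat \<Rightarrow> nat set" where
  "block s j = {j * s..<j * s + s}"

definition singles :: "nat \<Rightarrow> nat \<Rightarrow> nat \<Rightarrow> nat set set" where
  "singles s m t = {T. T \<subseteq> {m * s..<m * s + m} \<and> card T = t}"

definition block_edges :: "nat \<Rightarrow> nat \<Rightarrow> nat \<Rightarrow> nat set set" where
  "block_edges s m t = (\<lambda>(j, T). block s j \<union> T) ` ({..<m} \<times> singles s m t)"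

lemma block_edgesE:
  assumes "D \<in> block_edges s m t"
  obtains j T where "j < m" "T \<subseteq> {m * s..<m * s + m}" "card T = t" "D = block s j \<union> T"
  using assms by (auto simp: block_edges_def singles_def)

lemma block_subset:
  assumes "j < m"
  shows "block s j \<subseteq> {..<m * s}"
proof -
  have "j * s + s \<le> m * s"
    using assms mult_le_mono1[of "Suc j" m s] by simp
  then show ?thesis by (auto simp: block_def)
qed

lemma div_eq_if_in_block: "v \<in> block s j \<Longrightarrow> v div s = j"
  by (rule div_nat_eqI) (auto simp: block_def algebra_simps)

lemma in_block_iff: "s > 0 \<Longrightarrow> v \<in> block s j \<longleftrightarrow> v div s = j"
proof
  assume "s > 0" "v div s = j"
  moreover have "v div s * s + v mod s = v" by simp
  moreover have "v mod s < s" using \<open>s > 0\<close> by simp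
  ultimately show "v \<in> block s j" by (auto simp: block_def)
qed (rule div_eq_if_in_block)

lemma block_edges_twins:
  assumes "D \<in> block_edges s m t" "s > 0" "j < m" "u \<in> block s j" "v \<in> block s j"
  shows "u \<in> D \<longleftrightarrow> v \<in> D"
proof -
  obtain j' T where D: "T \<subseteq> {m * s..<m * s + m}" "D = block s j' \<union> T"
    using assms(1) by (rule block_edgesE)
  have "u \<notin> T" "v \<notin> T"
    using D(1) block_subset[OF \<open>j < m\<close>, of s] assms(4,5) by fastforce+
  moreover have "u \<in> block s j' \<longleftrightarrow> v \<in> block s j'"
    using assms by (simp add: in_block_iff)
  ultimately show ?thesis using D(2) by blast
qed

lemma block_edges_no_venn_family:
  assumes "\<And>i. i \<in> {1..k} \<Longrightarrow> E i \<in> block_edges s m t" and "s > 0" "k > 0"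
    and "t + 1 < 2 ^ (k - 1)"
  shows "\<not> venn_family k E"
proof
  assume venn: "venn_family k E"
  have one: "1 \<in> {1..k}" using \<open>k > 0\<close> by simp
  obtain j T where jT: "j < m" "T \<subseteq> {m * s..<m * s + m}" "card T = t" "E 1 = block s j \<union> T"
    using assms(1)[OF one] by (rule block_edgesE)
  have "finite T" using jT(2) by (rule finite_subset) simp
  from venn_family_edge_bound[OF venn one jT(4) this
      block_edges_twins[OF assms(1) \<open>s > 0\<close> jT(1)]]
  have "2 ^ (k - 1) \<le> t + 1" using jT(3) by simp
  with assms(4) show False by simp
qed

lemma card_in_block_edges:
  assumes "D \<in> block_edges s m t"
  shows "card D = s + t"
proof -
  obtain j T where jT: "j < m" "T \<subseteq> {m * s..<m * s + m}" "card T = t" "D = block s j \<union> T"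
    using assms by (rule block_edgesE)
  have "finite T" using jT(2) by (rule finite_subset) simp
  moreover have "block s j \<inter> T = {}"
    using block_subset[OF jT(1), of s] jT(2) by fastforce
  ultimately show ?thesis
    using jT(3,4) by (simp add: card_Un_disjoint block_def)
qed

lemma block_edges_subset:
  assumes "D \<in> block_edges s m t" "m * (s + 1) \<le> n"
  shows "D \<subseteq> {..<n}"
proof -
  obtain j T where jT: "j < m" "T \<subseteq> {m * s..<m * s + m}" "D = block s j \<union> T"
    using assms(1) by (rule block_edgesE)
  have "m * s + m \<le> n" using assms(2) by simp
  then show ?thesis using jT(2,3) block_subset[OF jT(1), of s] by fastforce
qed

text \<open>An edge determines its block and its single vertices, as its parts below and above the
  threshold \<open>m * s\<close>.\<close>

lemma card_block_edges:
  assumes "s > 0"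
  shows "card (block_edges s m t) = m * (m choose t)"
proof -
  have "inj_on (\<lambda>(j, T). block s j \<union> T) ({..<m} \<times> singles s m t)"
  proof (rule inj_onI, clarsimp)
    fix j T j' T'
    assume j: "j < m" "j' < m" and T: "T \<in> singles s m t" "T' \<in> singles s m t"
      and eq: "block s j \<union> T = block s j' \<union> T'"
    have T_eq: "(block s i \<union> R) \<inter> {m * s..} = R"
      and block_eq: "(block s i \<union> R) \<inter> {..<m * s} = block s i"
      if "i < m" "R \<in> singles s m t" for i R
      using block_subset[OF that(1), of s] that(2) by (fastforce simp: singles_def)+
    have "block s j = block s j'" using block_eq eq j T by metis
    moreover have "j * s \<in> block s j" using assms by (simp add: block_def)
    ultimately have "j * s \<in> block s j'" by simp
    then have "j = j'" using div_eq_if_in_block[of "j * s" s j'] assms by simp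
    moreover have "T = T'" using T_eq eq j T by metis
    ultimately show "j = j' \<and> T = T'" ..
  qed
  then have "card (block_edges s m t) = card ({..<m} \<times> singles s m t)"
    unfolding block_edges_def by (rule card_image)
  also have "\<dots> = m * (m choose t)"
    by (simp add: card_cartesian_product singles_def n_subsets)
  finally show ?thesis .
qed

text \<open>For large \<open>n\<close> the rounded value \<open>m = n div (s + 1)\<close> is at least half of \<open>n / (s + 1)\<close>, and
  \<open>m choose t \<ge> (m / t) ^ t\<close>. For \<open>t = 0\<close> the factor \<open>1 / real t ^ t\<close> is \<open>1\<close>.\<close>

lemma block_edges_growth:
  assumes "s > 0"
  shows "\<exists>c>0. \<forall>\<^sub>F n in sequentially.
    c * real n ^ (t + 1) \<le> real (card (block_edges s (n div (s + 1)) t))"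
proof (intro exI conjI)
  define c where "c = (1 / (2 * real (s + 1))) ^ (t + 1) / real t ^ t"
  show "c > 0" by (cases "t = 0") (auto simp: c_def)
  show "\<forall>\<^sub>F n in sequentially.
    c * real n ^ (t + 1) \<le> real (card (block_edges s (n div (s + 1)) t))"
    using eventually_ge_at_top[of "(t + 1) * (s + 1)"]
  proof eventually_elim
    case (elim n)
    define m where "m = n div (s + 1)"
    have m_ge: "t + 1 \<le> m"
      unfolding m_def using elim by (subst less_eq_div_iff_mult_less_eq) auto
    have "n < (m + 1) * (s + 1)"
      unfolding m_def using dividend_less_div_times[of "s + 1" n] by (simp add: algebra_simps)
    also have "\<dots> \<le> (2 * m) * (s + 1)" using m_ge by (intro mult_le_mono1) simp
    finally have "real n \<le> real (2 * m * (s + 1))" by (simp only: of_nat_le_iff)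
    then have n_le: "real n / (2 * real (s + 1)) \<le> real m" by (simp add: field_simps)
    have "c * real n ^ (t + 1) = (real n / (2 * real (s + 1))) ^ (t + 1) / real t ^ t"
      by (simp add: c_def power_divide)
    also have "\<dots> \<le> real m ^ (t + 1) / real t ^ t"
      using n_le by (intro divide_right_mono power_mono) auto
    also have "\<dots> = real m * (real m / real t) ^ t" by (simp add: power_divide)
    also have "\<dots> \<le> real m * real (m choose t)"
      using binomial_ge_n_over_k_pow_k[of t m, where 'a = real] m_ge
      by (intro mult_left_mono) auto
    also have "\<dots> = real (card (block_edges s m t))"
      by (simp add: card_block_edges[OF assms])
    finally show ?case unfolding m_def .
  qed
qed

section \<open>The lower bounds\<close>

text \<open>With \<open>d = 2 ^ (k - 1)\<close> the parameters are \<open>t = d - 2\<close> and \<open>s = r - t\<close>, so that an edge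
  consists of \<open>t + 1 = d - 1\<close> indivisible pieces.\<close>

lemma many_edges_without_venn_family:
  fixes k r :: nat
  assumes "k \<ge> 2" "r \<ge> 2 ^ (k - 1)"
  shows "\<exists>c>(0::real). \<forall>\<^sub>F n in sequentially. \<exists>H :: nat hypergraph.
    is_hypergraph H \<and> uniform r H \<and> card (hverts H) = n
    \<and> real (card (hedges H)) \<ge> c * real n ^ (2 ^ (k - 1) - 1)
    \<and> \<not> (\<exists>E. (\<forall>i\<in>{1..k}. E i \<in> hedges H) \<and> venn_family k E)"
proof -
  define t :: nat where "t = 2 ^ (k - 1) - 2"
  define s where "s = r - t"
  have "(2::nat) ^ 1 \<le> 2 ^ (k - 1)" using assms(1) by (intro power_increasing) auto
  then have t: "t + 2 = 2 ^ (k - 1)" unfolding t_def by simp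
  then have exp: "2 ^ (k - 1) - 1 = t + 1" by simp
  have s: "s > 0" "s + t = r" using t assms(2) unfolding s_def by simp_all
  obtain c :: real where "c > 0" and growth: "\<forall>\<^sub>F n in sequentially.
      c * real n ^ (t + 1) \<le> real (card (block_edges s (n div (s + 1)) t))"
    using block_edges_growth[OF s(1), of t] by blast
  show ?thesis
    unfolding exp
  proof (intro exI[of _ c] conjI \<open>c > 0\<close>, rule eventually_mono[OF growth], intro exI conjI)
    fix n :: nat
    let ?H = "\<lparr>hverts = {..<n}, hedges = block_edges s (n div (s + 1)) t\<rparr>"
    assume "c * real n ^ (t + 1) \<le> real (card (block_edges s (n div (s + 1)) t))"
    then show "c * real n ^ (t + 1) \<le> real (card (hedges ?H))" by simp
    show "is_hypergraph ?H"
      unfolding is_hypergraph_def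
    proof (intro conjI subsetI PowI)
      fix D v assume "D \<in> hedges ?H" "v \<in> D"
      then show "v \<in> hverts ?H"
        using block_edges_subset[of D s "n div (s + 1)" t n] div_times_less_eq_dividend[of n "s + 1"]
        by (auto simp del: One_nat_def)
    qed simp
    show "uniform r ?H" using card_in_block_edges s(2) by (auto simp: uniform_def)
    show "card (hverts ?H) = n" by simp
    show "\<not> (\<exists>E. (\<forall>i\<in>{1..k}. E i \<in> hedges ?H) \<and> venn_family k E)"
    proof (clarify)
      fix E assume E: "\<forall>i\<in>{1..k}. E i \<in> hedges ?H" and "venn_family k E"
      have "\<not> venn_family k E"
      proof (rule block_edges_no_venn_family)
        show "E i \<in> block_edges s (n div (s + 1)) t" if "i \<in> {1..k}" for i
          using E that by simp
      qed (use s(1) assms(1) t in linarith)+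
      then show False using \<open>venn_family k E\<close> ..
    qed
  qed
qed

lemma card_hedges_le_turan_ex:
  fixes H :: "nat hypergraph"
  assumes "is_hypergraph H" "uniform r H" "card (hverts H) = n" "\<not> contains_copy H F"
  shows "card (hedges H) \<le> turan_ex r n F"
  unfolding turan_ex_def using assms by (intro Max_ge turan_set_finite) blast

theorem theorem1p2:
  fixes k :: nat
  assumes "k \<ge> 2"
  shows "(\<lambda>n. real (turan_ex (2 ^ (k - 1)) n (VD_circ k))) \<in> \<Omega>(\<lambda>n. real n ^ (2 ^ (k - 1) - 1))
    \<and> (\<forall>r \<ge> 2 ^ (k - 1). \<exists>c > (0 :: real). \<forall>\<^sub>F n in sequentially.
          \<exists>H :: nat hypergraph.
            is_hypergraph H \<and> uniform r H \<and> card (hverts H) = n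
            \<and> real (card (hedges H)) \<ge> c * real n ^ (2 ^ (k - 1) - 1)
            \<and> \<not> contains_trace_copy H (VD k))"
proof (intro conjI allI impI)
  obtain c :: real where "c > 0" and ev: "\<forall>\<^sub>F n in sequentially. \<exists>H :: nat hypergraph.
      is_hypergraph H \<and> uniform (2 ^ (k - 1)) H \<and> card (hverts H) = n
      \<and> real (card (hedges H)) \<ge> c * real n ^ (2 ^ (k - 1) - 1)
      \<and> \<not> (\<exists>E. (\<forall>i\<in>{1..k}. E i \<in> hedges H) \<and> venn_family k E)"
    using many_edges_without_venn_family[OF assms order.refl] by blast
  show "(\<lambda>n. real (turan_ex (2 ^ (k - 1)) n (VD_circ k))) \<in> \<Omega>(\<lambda>n. real n ^ (2 ^ (k - 1) - 1))"
  proof (rule landau_omega.bigI[OF \<open>c > 0\<close>], rule eventually_mono[OF ev], elim exE conjE)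
    fix n and H :: "nat hypergraph"
    assume H: "is_hypergraph H" "uniform (2 ^ (k - 1)) H" "card (hverts H) = n"
      and ge: "c * real n ^ (2 ^ (k - 1) - 1) \<le> real (card (hedges H))"
      and no_venn: "\<not> (\<exists>E. (\<forall>i\<in>{1..k}. E i \<in> hedges H) \<and> venn_family k E)"
    have "\<not> contains_copy H (VD_circ k)"
      using no_venn venn_family_if_contains_copy[of H "VD_circ k" k]
      by (auto simp: VD_circ_def VD_def)
    then have "real (card (hedges H)) \<le> real (turan_ex (2 ^ (k - 1)) n (VD_circ k))"
      using card_hedges_le_turan_ex[OF H] by simp
    with ge show "c * norm (real n ^ (2 ^ (k - 1) - 1))
        \<le> norm (real (turan_ex (2 ^ (k - 1)) n (VD_circ k)))"
      by simp
  qed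
next
  fix r :: nat
  assume "r \<ge> 2 ^ (k - 1)"
  then obtain c :: real where "c > 0" and ev: "\<forall>\<^sub>F n in sequentially. \<exists>H :: nat hypergraph.
      is_hypergraph H \<and> uniform r H \<and> card (hverts H) = n
      \<and> real (card (hedges H)) \<ge> c * real n ^ (2 ^ (k - 1) - 1)
      \<and> \<not> (\<exists>E. (\<forall>i\<in>{1..k}. E i \<in> hedges H) \<and> venn_family k E)"
    using many_edges_without_venn_family[OF assms] by blast
  from ev have "\<forall>\<^sub>F n in sequentially. \<exists>H :: nat hypergraph.
      is_hypergraph H \<and> uniform r H \<and> card (hverts H) = n
      \<and> real (card (hedges H)) \<ge> c * real n ^ (2 ^ (k - 1) - 1)
      \<and> \<not> contains_trace_copy H (VD k)"
    by (rule eventually_mono) (use venn_family_if_contains_trace_copy in blast)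
  with \<open>c > 0\<close> show "\<exists>c > (0 :: real). \<forall>\<^sub>F n in sequentially. \<exists>H :: nat hypergraph.
      is_hypergraph H \<and> uniform r H \<and> card (hverts H) = n
      \<and> real (card (hedges H)) \<ge> c * real n ^ (2 ^ (k - 1) - 1)
      \<and> \<not> contains_trace_copy H (VD k)"
    by blast
qed

end
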